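(* There is an absolute constant $C>0$ such that the following holds. Let $K\ge1$, let $\mathbf{\Phi}\in\mathbb{R}^{m\times n}$ satisfy the RIP of order $2K$ with isometry constant $\delta_{2K}\in(0,1)$, let $\mathbf{x}\in\mathbb{R}^n$ with $|\mathrm{supp}(\mathbf{x})|=K$, let $\mathbf{v}\in\mathbb{R}^m$, and let $\mathbf{y}=\mathbf{\Phi}\mathbf{x}+\mathbf{v}$. Let $\kappa := \max_{i,j\in\mathrm{supp}(\mathbf{x})} |x_i|/|x_j|$. If $\mathrm{SNR} \ge \kappa^2\delta_{2K}^{-3/2}$, then the support $\mathcal{T}^K$ output by OMP after $K$ iterations satisfies $$\rho_{\mathrm{error}} := \frac{|\mathcal{T}^K\setminus\mathrm{supp}(\mathbf{x})|}{|\mathrm{supp}(\mathbf{x})|} \le C\,\kappa^2\,\delta_{2K}^{1/2}.$$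
   Context: $\phi_i$ is the $i$-th column of $\mathbf{\Phi}$. RIP: for an integer $s\ge1$, the isometry constant $\delta_s$ of $\mathbf{\Phi}$ is the smallest $c\in[0,1)$ such that $(1-c)\|\mathbf{z}\|_2^2 \le \|\mathbf{\Phi}\mathbf{z}\|_2^2 \le (1+c)\|\mathbf{z}\|_2^2$ for all $s$-sparse $\mathbf{z}\in\mathbb{R}^n$. $\mathrm{SNR} := \|\mathbf{\Phi}\mathbf{x}\|_2^2/\|\mathbf{v}\|_2^2$ (taken as $+\infty$ if $\mathbf{v}=\mathbf{0}$). OMP with input $\mathbf{\Phi},\mathbf{y},K$: set $\mathcal{T}^0=\emptyset$, $\mathbf{r}^0=\mathbf{y}$; for $k=1,\dots,K$: choose $t^k \in \arg\max_{i\notin\mathcal{T}^{k-1}} |\langle\phi_i,\mathbf{r}^{k-1}\rangle|$ (ties broken arbitrarily), set $\mathcal{T}^k=\mathcal{T}^{k-1}\cup\{t^k\}$, $\mathbf{x}^k = \arg\min_{\mathrm{supp}(\mathbf{u})\subseteq\mathcal{T}^k}\|\mathbf{y}-\mathbf{\Phi}\mathbf{u}\|_2$, $\mathbf{r}^k=\mathbf{y}-\mathbf{\Phi}\mathbf{x}^k$. Output $\mathcal{T}^K$, $\mathbf{x}^K$. *)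

theory Defs
  imports Complex_Main
begin

text \<open>Vectors in R^n are functions nat => real, only indices i < n matter.
  A matrix in R^(m x n) is a function A :: nat => nat => real, entry (j,i) = A j i,
  with j < m (rows) and i < n (columns).\<close>

definition supp :: "nat \<Rightarrow> (nat \<Rightarrow> real) \<Rightarrow> nat set" where
  "supp n x = {i. i < n \<and> x i \<noteq> 0}"

definition mv :: "nat \<Rightarrow> (nat \<Rightarrow> nat \<Rightarrow> real) \<Rightarrow> (nat \<Rightarrow> real) \<Rightarrow> (nat \<Rightarrow> real)" where
  "mv n A x = (\<lambda>j. \<Sum>i<n. A j i * x i)"

definition ip :: "nat \<Rightarrow> (nat \<Rightarrow> real) \<Rightarrow> (nat \<Rightarrow> real) \<Rightarrow> real" where
  "ip m u w = (\<Sum>j<m. u j * w j)"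

definition sqn :: "nat \<Rightarrow> (nat \<Rightarrow> real) \<Rightarrow> real" where
  "sqn m u = (\<Sum>j<m. (u j)^2)"

definition col :: "(nat \<Rightarrow> nat \<Rightarrow> real) \<Rightarrow> nat \<Rightarrow> (nat \<Rightarrow> real)" where
  "col A i = (\<lambda>j. A j i)"

definition rip_holds :: "nat \<Rightarrow> nat \<Rightarrow> (nat \<Rightarrow> nat \<Rightarrow> real) \<Rightarrow> nat \<Rightarrow> real \<Rightarrow> bool" where
  "rip_holds m n A s c \<longleftrightarrow>
     (\<forall>z. card (supp n z) \<le> s \<longrightarrow>
        (1 - c) * sqn n z \<le> sqn m (mv n A z) \<and> sqn m (mv n A z) \<le> (1 + c) * sqn n z)"

definition ric :: "nat \<Rightarrow> nat \<Rightarrow> (nat \<Rightarrow> nat \<Rightarrow> real) \<Rightarrow> nat \<Rightarrow> real" where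
  "ric m n A s = Inf {c. 0 \<le> c \<and> c < 1 \<and> rip_holds m n A s c}"

definition ls_resid :: "nat \<Rightarrow> nat \<Rightarrow> (nat \<Rightarrow> nat \<Rightarrow> real) \<Rightarrow> (nat \<Rightarrow> real) \<Rightarrow> nat set \<Rightarrow> (nat \<Rightarrow> real)" where
  "ls_resid m n A y T =
     (let u = (SOME u. (\<forall>i. i \<notin> T \<longrightarrow> u i = 0) \<and>
                (\<forall>w. (\<forall>i. i \<notin> T \<longrightarrow> w i = 0) \<longrightarrow>
                      sqn m (\<lambda>j. y j - mv n A u j) \<le> sqn m (\<lambda>j. y j - mv n A w j)))
      in (\<lambda>j. y j - mv n A u j))"

text \<open>T is a possible support output of OMP after K iterations (any tie-breaking):
  t k is the index chosen at iteration k, T^k = t ` {1..k}.\<close>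
definition omp_output :: "nat \<Rightarrow> nat \<Rightarrow> (nat \<Rightarrow> nat \<Rightarrow> real) \<Rightarrow> (nat \<Rightarrow> real) \<Rightarrow> nat \<Rightarrow> nat set \<Rightarrow> bool" where
  "omp_output m n A y K T \<longleftrightarrow>
     (\<exists>t :: nat \<Rightarrow> nat.
        (\<forall>k\<in>{1..K}.
           t k < n \<and> t k \<notin> t ` {1..<k} \<and>
           (\<forall>i<n. i \<notin> t ` {1..<k} \<longrightarrow>
              \<bar>ip m (col A i) (ls_resid m n A y (t ` {1..<k}))\<bar>
                \<le> \<bar>ip m (col A (t k)) (ls_resid m n A y (t ` {1..<k}))\<bar>))
        \<and> T = t ` {1..K})"

end

theory Submission
  imports Defs "HOL-Analysis.L2_Norm"
begin

text \<open>The proof counts energy. Write \<open>S\<close> for the support of \<open>x\<close>, \<open>\<mu>\<close> and \<open>M\<close> for its smallest and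
  largest magnitude, and \<open>w\<close> for the number of wrong selections. The restricted isometry property
  makes the correlations on the unselected part of \<open>S\<close> agree with the entries of \<open>x\<close> in an averaged
  sense: among any \<open>h\<close> of them there is one with
  \<open>|x\<^sub>j| \<le> g + O(\<delta>\<^bsup>3/4\<^esup> M sqrt (K / h))\<close>, where \<open>g\<close> is the largest correlation,
  and \<open>g\<^sup>2\<close> is at most \<open>1 + \<delta>\<close> times the drop of the squared residual in this step.
  Taking \<open>h\<close> about \<open>sqrt \<delta> K\<close>, the correct selections remove from the residual all the energy of
  the selected part of \<open>x\<close> up to \<open>O(sqrt \<delta> K M\<^sup>2)\<close>, provided that \<open>h - 1\<close> indices are exempted, which
  costs at most \<open>(h - 1) M\<^sup>2\<close>. Unless \<open>w\<close> is small already, every wrong selection removes another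
  \<open>\<mu>\<^sup>2 / 4\<close>. As the total drop exceeds the energy of the selected part of \<open>x\<close> by at most
  \<open>O(sqrt \<delta> K M\<^sup>2)\<close>, this gives \<open>w \<mu>\<^sup>2 = O(sqrt \<delta> K M\<^sup>2)\<close>.\<close>

section \<open>Inner products, squared norms and matrix-vector products\<close>

lemma sqn_eq_L2_set: "sqn m u = (L2_set u {..<m})\<^sup>2"
  by (simp add: sqn_def L2_set_def sum_nonneg)

lemma sqn_eq_ip: "sqn m u = ip m u u"
  by (simp add: sqn_def ip_def power2_eq_square)

lemma ip_commute: "ip m u w = ip m w u"
  by (simp add: ip_def mult.commute)

lemma ip_add_left: "ip m (\<lambda>j. u j + w j) z = ip m u z + ip m w z"
  by (simp add: ip_def sum.distrib algebra_simps)

lemma ip_diff_left: "ip m (\<lambda>j. u j - w j) z = ip m u z - ip m w z"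
  by (simp add: ip_def sum_subtractf algebra_simps)

lemma ip_scale_left: "ip m (\<lambda>j. a * u j) z = a * ip m u z"
  by (simp add: ip_def sum_distrib_left algebra_simps)

lemma ip_add_right: "ip m z (\<lambda>j. u j + w j) = ip m z u + ip m z w"
  by (simp add: ip_def sum.distrib algebra_simps)

lemma ip_diff_right: "ip m z (\<lambda>j. u j - w j) = ip m z u - ip m z w"
  by (simp add: ip_def sum_subtractf algebra_simps)

lemma ip_scale_right: "ip m z (\<lambda>j. a * u j) = a * ip m z u"
  by (simp add: ip_def sum_distrib_left algebra_simps)

lemmas ip_bilinear = ip_add_left ip_diff_left ip_scale_left ip_add_right ip_diff_right ip_scale_right

lemma abs_ip_le: "\<bar>ip m u w\<bar> \<le> L2_set u {..<m} * L2_set w {..<m}"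
proof -
  have "\<bar>ip m u w\<bar> \<le> (\<Sum>j<m. \<bar>u j\<bar> * \<bar>w j\<bar>)"
    unfolding ip_def by (rule order_trans[OF sum_abs]) (simp add: abs_mult)
  also have "\<dots> \<le> L2_set u {..<m} * L2_set w {..<m}"
    by (rule L2_set_mult_ineq)
  finally show ?thesis .
qed

lemma mv_add: "mv n A (\<lambda>i. u i + w i) = (\<lambda>j. mv n A u j + mv n A w j)"
  by (simp add: mv_def sum.distrib algebra_simps)

lemma mv_diff: "mv n A (\<lambda>i. u i - w i) = (\<lambda>j. mv n A u j - mv n A w j)"
  by (simp add: mv_def sum_subtractf algebra_simps)

lemma mv_scale: "mv n A (\<lambda>i. a * u i) = (\<lambda>j. a * mv n A u j)"
  by (simp add: mv_def sum_distrib_left algebra_simps)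

lemmas mv_linear = mv_add mv_diff mv_scale

lemma mv_unit:
  assumes "t < n"
  shows "mv n A (\<lambda>i. if i = t then 1 else 0) = col A t"
  using assms by (simp add: mv_def col_def if_distrib cong: if_cong)

lemma ip_mv: "ip m (mv n A z) r = (\<Sum>i<n. z i * ip m (col A i) r)"
proof -
  have "ip m (mv n A z) r = (\<Sum>j<m. \<Sum>i<n. z i * (A j i * r j))"
    by (simp add: ip_def mv_def sum_distrib_right sum_distrib_left algebra_simps)
  also have "\<dots> = (\<Sum>i<n. \<Sum>j<m. z i * (A j i * r j))"
    by (rule sum.swap)
  finally show ?thesis
    by (simp add: ip_def col_def sum_distrib_left)
qed

lemma ip_mv_supported:
  assumes "\<And>i. i < n \<Longrightarrow> i \<notin> T \<Longrightarrow> z i = 0"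
    and "\<And>i. i \<in> T \<Longrightarrow> ip m (col A i) r = 0"
  shows "ip m (mv n A z) r = 0"
  unfolding ip_mv using assms by (intro sum.neutral) force

section \<open>Least-squares residuals\<close>

lemma sqn_eq_0_ip:
  assumes "sqn m p = 0"
  shows "ip m p w = 0"
  using abs_ip_le[of m p w] assms by (simp add: sqn_eq_L2_set)

text \<open>Gram-Schmidt by induction on \<open>T\<close>. The hypothesis is applied both to
  \<open>y\<close> and to the new column, hence \<open>arbitrary: y\<close>. Subtracting from the
  residual its component along the orthogonalized column \<open>p\<close> preserves orthogonality to
  the old columns and creates it for the new one.\<close>

lemma normal_equations_solvable:
  assumes "finite T" "T \<subseteq> {..<n}"
  shows "\<exists>u. (\<forall>i. i \<notin> T \<longrightarrow> u i = 0) \<and>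
             (\<forall>i\<in>T. ip m (col A i) (\<lambda>j. y j - mv n A u j) = 0)"
  using assms
proof (induction T arbitrary: y rule: finite_induct)
  case empty
  show ?case by (intro exI[of _ "\<lambda>_. 0"]) simp
next
  case (insert t T)
  define orth where "orth r \<longleftrightarrow> (\<forall>i\<in>T. ip m (col A i) r = 0)" for r :: "nat \<Rightarrow> real"
  obtain u where u: "\<And>i. i \<notin> T \<Longrightarrow> u i = 0" "orth (\<lambda>j. y j - mv n A u j)"
    unfolding orth_def using insert.IH[of y] insert.prems by auto
  obtain w where w: "\<And>i. i \<notin> T \<Longrightarrow> w i = 0" "orth (\<lambda>j. col A t j - mv n A w j)"
    unfolding orth_def using insert.IH[of "col A t"] insert.prems by auto
  define r where "r = (\<lambda>j. y j - mv n A u j)"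
  define p where "p = (\<lambda>j. col A t j - mv n A w j)"
  define \<alpha> where "\<alpha> = ip m p r / ip m p p"
  define u' where "u' = (\<lambda>i. u i + \<alpha> * ((if i = t then 1 else 0) - w i))"
  have r': "(\<lambda>j. y j - mv n A u' j) = (\<lambda>j. r j - \<alpha> * p j)"
    using insert.prems by (auto simp: u'_def mv_linear mv_unit r_def p_def algebra_simps)
  have orth': "ip m (col A i) (\<lambda>j. r j - \<alpha> * p j) = 0" if "i \<in> T" for i
    using that u(2) w(2) unfolding orth_def r_def[symmetric] p_def[symmetric]
    by (simp add: ip_bilinear)
  have col_t: "col A t = (\<lambda>j. p j + mv n A w j)"
    by (simp add: p_def)
  have "ip m (mv n A w) (\<lambda>j. r j - \<alpha> * p j) = 0"
    by (rule ip_mv_supported[of _ T]) (use w(1) orth' in auto)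
  \<comment> \<open>If the new column depends on the old ones, \<open>p\<close> has norm zero. Then
    division by zero makes \<open>\<alpha>\<close> zero, and \<open>r\<close> is already orthogonal
    to \<open>p\<close>.\<close>
  moreover have "ip m p (\<lambda>j. r j - \<alpha> * p j) = 0"
    unfolding ip_bilinear using sqn_eq_0_ip[of m p r]
    by (cases "ip m p p = 0") (simp_all add: \<alpha>_def sqn_eq_ip)
  ultimately have "ip m (col A t) (\<lambda>j. r j - \<alpha> * p j) = 0"
    unfolding col_t by (simp only: ip_add_left)
  with orth' have "\<forall>i\<in>insert t T. ip m (col A i) (\<lambda>j. y j - mv n A u' j) = 0"
    unfolding r' by simp
  moreover have "\<forall>i. i \<notin> insert t T \<longrightarrow> u' i = 0"
    using u(1) w(1) by (auto simp: u'_def)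
  ultimately show ?case by blast
qed

text \<open>Pythagoras: competing residuals differ by a combination of columns in \<open>T\<close>,
  which is orthogonal to a residual solving the normal equations. This supplies the witness for the
  choice operator in \<open>ls_resid\<close>.\<close>

lemma least_squares_exists:
  assumes "finite T" "T \<subseteq> {..<n}"
  shows "\<exists>u. (\<forall>i. i \<notin> T \<longrightarrow> u i = 0) \<and>
           (\<forall>w. (\<forall>i. i \<notin> T \<longrightarrow> w i = 0) \<longrightarrow>
              sqn m (\<lambda>j. y j - mv n A u j) \<le> sqn m (\<lambda>j. y j - mv n A w j))"
proof -
  obtain u where u: "\<And>i. i \<notin> T \<Longrightarrow> u i = 0"
      "\<And>i. i \<in> T \<Longrightarrow> ip m (col A i) (\<lambda>j. y j - mv n A u j) = 0"
    using normal_equations_solvable[OF assms] by metis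
  have "sqn m (\<lambda>j. y j - mv n A u j) \<le> sqn m (\<lambda>j. y j - mv n A w j)"
    if w: "\<forall>i. i \<notin> T \<longrightarrow> w i = 0" for w
  proof -
    define r where "r = (\<lambda>j. y j - mv n A u j)"
    define d where "d = mv n A (\<lambda>i. u i - w i)"
    have "ip m d r = 0"
      unfolding d_def r_def by (rule ip_mv_supported[of _ T]) (use u w in auto)
    moreover have "(\<lambda>j. y j - mv n A w j) = (\<lambda>j. r j + d j)"
      by (auto simp: r_def d_def mv_diff)
    ultimately have "sqn m (\<lambda>j. y j - mv n A w j) = sqn m r + sqn m d"
      by (simp add: sqn_eq_ip ip_bilinear ip_commute[of m r d])
    then show ?thesis
      by (simp add: r_def[symmetric] sqn_eq_L2_set)
  qed
  with u(1) show ?thesis by blast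
qed

lemma ls_resid_obtain:
  assumes "finite T" "T \<subseteq> {..<n}"
  obtains u where "\<And>i. i \<notin> T \<Longrightarrow> u i = 0"
    and "ls_resid m n A y T = (\<lambda>j. y j - mv n A u j)"
    and "\<And>w. (\<And>i. i \<notin> T \<Longrightarrow> w i = 0) \<Longrightarrow>
           sqn m (ls_resid m n A y T) \<le> sqn m (\<lambda>j. y j - mv n A w j)"
  using someI_ex[OF least_squares_exists[OF assms, of m y A]] that
  unfolding ls_resid_def Let_def by blast

lemma sqn_ls_resid_le:
  assumes "finite T" "T \<subseteq> {..<n}"
  shows "sqn m (ls_resid m n A y T) \<le> sqn m y"
proof -
  obtain u where "\<And>w. (\<And>i. i \<notin> T \<Longrightarrow> w i = 0) \<Longrightarrow>
           sqn m (ls_resid m n A y T) \<le> sqn m (\<lambda>j. y j - mv n A w j)"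
    by (rule ls_resid_obtain[OF assms, of m A y]) blast
  from this[of "\<lambda>_. 0"] show ?thesis by (simp add: mv_def)
qed

text \<open>The new residual is no longer than that of the old minimizer moved by
  \<open>\<alpha>\<close> along column \<open>t\<close>. Minimizing the resulting quadratic in
  \<open>\<alpha>\<close> gives the bound.\<close>

lemma sqn_ls_resid_insert:
  assumes "finite T" "insert t T \<subseteq> {..<n}"
  shows "(ip m (col A t) (ls_resid m n A y T))\<^sup>2
      \<le> sqn m (col A t) * (sqn m (ls_resid m n A y T) - sqn m (ls_resid m n A y (insert t T)))"
proof -
  define r where "r = ls_resid m n A y T"
  define p where "p = col A t"
  obtain u where u: "\<And>i. i \<notin> T \<Longrightarrow> u i = 0" "r = (\<lambda>j. y j - mv n A u j)"
    by (rule ls_resid_obtain[of T n m A y]) (use assms r_def in auto)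
  have le: "sqn m (ls_resid m n A y (insert t T)) \<le> sqn m r - 2 * \<alpha> * ip m p r + \<alpha>\<^sup>2 * sqn m p" for \<alpha>
  proof -
    define w where "w = (\<lambda>i. u i + \<alpha> * (if i = t then 1 else 0))"
    have w: "w i = 0" if "i \<notin> insert t T" for i
      using that u(1) by (auto simp: w_def)
    have "(\<lambda>j. y j - mv n A w j) = (\<lambda>j. r j - \<alpha> * p j)"
      using assms by (auto simp: w_def u(2) mv_linear mv_unit p_def)
    moreover have "sqn m (ls_resid m n A y (insert t T)) \<le> sqn m (\<lambda>j. y j - mv n A w j)"
      by (rule ls_resid_obtain[of "insert t T" n m A y]) (use assms w in auto)
    ultimately show ?thesis
      by (simp add: sqn_eq_ip ip_bilinear ip_commute[of m r p] power2_eq_square algebra_simps)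
  qed
  have "(ip m p r)\<^sup>2 \<le> sqn m p * (sqn m r - sqn m (ls_resid m n A y (insert t T)))"
  proof (cases "sqn m p = 0")
    case True
    then show ?thesis using sqn_eq_0_ip[OF True, of r] by simp
  next
    case False
    then have pos: "sqn m p > 0" by (simp add: sqn_eq_L2_set)
    show ?thesis using le[of "ip m p r / sqn m p"] pos
      by (simp add: field_simps power2_eq_square)
  qed
  then show ?thesis by (simp add: r_def p_def)
qed

section \<open>Consequences of the restricted isometry property\<close>

text \<open>For each fixed nonzero \<open>z\<close>, the two inequalities say that \<open>c\<close>
  is at least a number determined by \<open>z\<close>, and such bounds pass to the infimum.\<close>

lemma rip_holds_ric:
  assumes "\<exists>c. 0 \<le> c \<and> c < 1 \<and> rip_holds m n A s c"
  shows "rip_holds m n A s (ric m n A s)"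
proof -
  define P where "P = {c. 0 \<le> c \<and> c < 1 \<and> rip_holds m n A s c}"
  have ne: "P \<noteq> {}" using assms by (auto simp: P_def)
  have ric: "ric m n A s = Inf P" by (simp add: ric_def P_def)
  show ?thesis
    unfolding rip_holds_def ric
  proof (intro allI impI)
    fix z assume z: "card (supp n z) \<le> s"
    have nonneg: "sqn n z \<ge> 0" by (simp add: sqn_eq_L2_set)
    have bd: "(1 - c) * sqn n z \<le> sqn m (mv n A z)" "sqn m (mv n A z) \<le> (1 + c) * sqn n z"
      if "c \<in> P" for c
      using that z by (auto simp: P_def rip_holds_def)
    show "(1 - Inf P) * sqn n z \<le> sqn m (mv n A z) \<and> sqn m (mv n A z) \<le> (1 + Inf P) * sqn n z"
    proof (cases "sqn n z = 0")
      case True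
      then show ?thesis using bd ne by fastforce
    next
      case False
      with nonneg have pos: "sqn n z > 0" by simp
      have "1 - sqn m (mv n A z) / sqn n z \<le> Inf P"
        by (rule cInf_greatest[OF ne]) (use bd(1) pos in \<open>simp add: field_simps\<close>)
      moreover have "sqn m (mv n A z) / sqn n z - 1 \<le> Inf P"
        by (rule cInf_greatest[OF ne]) (use bd(2) pos in \<open>simp add: field_simps\<close>)
      ultimately show ?thesis using pos by (simp add: field_simps)
    qed
  qed
qed

text \<open>Polarization with \<open>z + u\<close> and \<open>z - u\<close> gives a bound by the
  arithmetic mean of the squared norms. Rescaling both vectors to the common norm
  \<open>a * b\<close> turns the mean into the product.\<close>

lemma rip_polarization:
  assumes rip: "rip_holds m n A s \<delta>" and \<delta>: "0 \<le> \<delta>"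
    and U: "finite U" "card U \<le> s" "supp n z \<subseteq> U" "supp n u \<subseteq> U"
  shows "\<bar>ip m (mv n A z) (mv n A u) - ip n z u\<bar> \<le> \<delta> * L2_set z {..<n} * L2_set u {..<n}"
proof -
  have half: "\<bar>ip m (mv n A z) (mv n A u) - ip n z u\<bar> \<le> \<delta> / 2 * (sqn n z + sqn n u)"
    if "supp n z \<subseteq> U" "supp n u \<subseteq> U" for z u
  proof -
    have sub: "supp n (\<lambda>i. z i + u i) \<subseteq> U" "supp n (\<lambda>i. z i - u i) \<subseteq> U"
      using that by (force simp: supp_def)+
    have cards: "card (supp n (\<lambda>i. z i + u i)) \<le> s" "card (supp n (\<lambda>i. z i - u i)) \<le> s"
      using card_mono[OF U(1) sub(1)] card_mono[OF U(1) sub(2)] U(2) by auto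
    show ?thesis
      using cards(1)[THEN rip[unfolded rip_holds_def, rule_format]]
        cards(2)[THEN rip[unfolded rip_holds_def, rule_format]]
      by (simp add: sqn_eq_ip mv_linear ip_bilinear ip_commute[of n u z]
          ip_commute[of m "mv n A u" "mv n A z"] abs_le_iff algebra_simps)
  qed
  define a b where "a = L2_set z {..<n}" and "b = L2_set u {..<n}"
  have ab: "a \<ge> 0" "b \<ge> 0" by (simp_all add: a_def b_def)
  show ?thesis
  proof (cases "a = 0 \<or> b = 0")
    case True
    then have "(\<forall>i<n. z i = 0) \<or> (\<forall>i<n. u i = 0)"
      by (auto simp: a_def b_def L2_set_eq_0_iff)
    then have "ip m (mv n A z) (mv n A u) = 0 \<and> ip n z u = 0"
      by (auto simp: ip_def mv_def)
    then show ?thesis using \<delta> by simp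
  next
    case False
    with ab have pos: "a * b > 0" by simp
    have "supp n (\<lambda>i. b * z i) \<subseteq> U" "supp n (\<lambda>i. a * u i) \<subseteq> U"
      using U by (auto simp: supp_def)
    from half[OF this]
    have "\<bar>(a * b) * (ip m (mv n A z) (mv n A u) - ip n z u)\<bar>
        \<le> \<delta> / 2 * (b\<^sup>2 * sqn n z + a\<^sup>2 * sqn n u)"
      by (simp add: mv_scale ip_bilinear sqn_eq_ip power2_eq_square algebra_simps)
    also have "\<dots> = (a * b) * (\<delta> * a * b)"
      by (simp add: sqn_eq_L2_set a_def b_def power2_eq_square algebra_simps)
    finally have "(a * b) * \<bar>ip m (mv n A z) (mv n A u) - ip n z u\<bar> \<le> (a * b) * (\<delta> * a * b)"
      using ab by (simp add: abs_mult)
    then show ?thesis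
      using pos by (simp only: mult_le_cancel_left_pos a_def b_def)
  qed
qed

text \<open>Tested against the sign pattern of \<open>u\<close> on \<open>Q\<close>, the correlations add up to the
  \<open>\<ell>\<^sub>1\<close> norm of \<open>u\<close> on \<open>Q\<close> up to an error of order \<open>sqrt |Q|\<close>.\<close>
lemma correlation_lower_bound:
  assumes rip: "rip_holds m n A s \<delta>" and \<delta>: "0 \<le> \<delta>" "\<delta> \<le> 1"
    and U: "finite U" "card U \<le> s" "supp n u \<subseteq> U"
    and Q: "Q \<subseteq> U" "Q \<subseteq> {..<n}" "Q \<noteq> {}"
    and g: "\<And>i. i \<in> Q \<Longrightarrow> \<bar>ip m (col A i) (\<lambda>j. mv n A u j + v j)\<bar> \<le> g"
  shows "\<exists>i\<in>Q. \<bar>u i\<bar> \<le> g + (\<delta> * L2_set u {..<n} + 2 * L2_set v {..<m}) / sqrt (card Q)"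
proof (rule ccontr)
  define a b where "a = L2_set u {..<n}" and "b = L2_set v {..<m}"
  define N where "N = sqrt (card Q)"
  define z where "z = (\<lambda>i. if i \<in> Q then sgn (u i) else 0)"
  have fin: "finite Q" using Q(1) U(1) finite_subset by blast
  have N: "N > 0" "N * N = card Q"
    using fin Q(3) by (auto simp: N_def card_gt_0_iff)
  assume "\<not> ?thesis"
  then have gt: "g + (\<delta> * a + 2 * b) / N < \<bar>u i\<bar>" if "i \<in> Q" for i
    using that by (force simp: a_def b_def N_def not_le)
  have ab: "a \<ge> 0" "b \<ge> 0" by (simp_all add: a_def b_def)
  have restrict: "(\<Sum>i<n. z i * f i) = (\<Sum>i\<in>Q. sgn (u i) * f i)" for f
  proof -
    have "(\<Sum>i<n. z i * f i) = (\<Sum>i\<in>Q. z i * f i)"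
      by (rule sum.mono_neutral_right) (use Q in \<open>auto simp: z_def\<close>)
    then show ?thesis by (simp add: z_def)
  qed
  have "sqn n z \<le> (\<Sum>i<n. if i \<in> Q then 1 else 0)"
    unfolding sqn_def by (rule sum_mono) (auto simp: z_def sgn_if)
  also have "\<dots> = card ({..<n} \<inter> Q)" by (simp add: sum.If_cases)
  also have "{..<n} \<inter> Q = Q" using Q by auto
  finally have "sqn n z \<le> N\<^sup>2" using N by (simp add: power2_eq_square)
  then have nz: "L2_set z {..<n} \<le> N"
    using N(1) by (auto simp: sqn_eq_L2_set intro: power2_le_imp_le)
  have suppz: "supp n z \<subseteq> U" using Q by (auto simp: supp_def z_def)
  have "sqn m (mv n A z) \<le> (1 + \<delta>) * sqn n z"
    using rip card_mono[OF U(1) suppz] U(2) by (auto simp: rip_holds_def)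
  also have "\<dots> \<le> 4 * N\<^sup>2"
    using \<open>sqn n z \<le> N\<^sup>2\<close> \<delta> by (intro mult_mono) (auto simp: sqn_eq_L2_set)
  finally have "(L2_set (mv n A z) {..<m})\<^sup>2 \<le> (2 * N)\<^sup>2"
    by (simp add: sqn_eq_L2_set power_mult_distrib)
  then have nAz: "L2_set (mv n A z) {..<m} \<le> 2 * N"
    using N(1) by (auto intro: power2_le_imp_le)
  have "\<bar>ip m (mv n A z) (mv n A u) - ip n z u\<bar> \<le> \<delta> * L2_set z {..<n} * a"
    unfolding a_def by (rule rip_polarization[OF rip \<delta>(1) U(1,2) suppz U(3)])
  also have "\<dots> \<le> \<delta> * N * a"
    using nz \<delta> ab N by (intro mult_mono) auto
  finally have 1: "\<bar>ip m (mv n A z) (mv n A u) - ip n z u\<bar> \<le> \<delta> * N * a" .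
  have "\<bar>ip m (mv n A z) v\<bar> \<le> L2_set (mv n A z) {..<m} * b"
    unfolding b_def by (rule abs_ip_le)
  also have "\<dots> \<le> 2 * N * b" using nAz ab by (intro mult_right_mono) auto
  finally have 2: "\<bar>ip m (mv n A z) v\<bar> \<le> 2 * N * b" .
  have "ip m (mv n A z) (\<lambda>j. mv n A u j + v j) \<le> (\<Sum>i\<in>Q. g)"
    unfolding ip_mv restrict
  proof (rule sum_mono)
    fix i assume "i \<in> Q"
    then show "sgn (u i) * ip m (col A i) (\<lambda>j. mv n A u j + v j) \<le> g"
      using g[of i] by (auto simp: sgn_if)
  qed
  then have 3: "ip m (mv n A z) (mv n A u) + ip m (mv n A z) v \<le> N * N * g"
    using N by (simp add: ip_add_right)
  \<comment> \<open>If every \<open>\<bar>u i\<bar>\<close> on \<open>Q\<close> exceeded the claimed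
    bound, the inner product of \<open>z\<close> and \<open>u\<close> would be larger than the three
    estimates above allow.\<close>
  have "N * N * g + N * (\<delta> * a + 2 * b) = N * N * (g + (\<delta> * a + 2 * b) / N)"
    using N(1) by (simp add: field_simps)
  also have "\<dots> = (\<Sum>i\<in>Q. g + (\<delta> * a + 2 * b) / N)"
    using N by simp
  also have "\<dots> < (\<Sum>i\<in>Q. \<bar>u i\<bar>)"
    using fin Q(3) gt by (intro sum_strict_mono) auto
  also have "\<dots> = ip n z u"
    unfolding ip_def restrict by (simp add: sgn_mult_self_eq mult.commute abs_sgn)
  finally have "N * N * g + N * (\<delta> * a + 2 * b) < ip n z u"
    .
  with 1 2 3 show False by (simp add: algebra_simps abs_le_iff)
qed

text \<open>One step, read backwards, of the potential ``energy outside the \<open>h - 1\<close> exempted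
  indices''. Putting \<open>i\<close> back exempts it; if that is one index too many, some \<open>j\<close> with
  small \<open>x j\<close> among the \<open>h\<close> exempted ones is released.\<close>
lemma exempt_energy_step:
  fixes x :: "'a \<Rightarrow> real"
  assumes fin: "finite G" and i: "i \<in> G" and H: "H \<subseteq> G - {i}" "card H < h" and b: "0 \<le> b"
    and small: "\<And>Q. Q \<subseteq> G \<Longrightarrow> card Q = h \<Longrightarrow> \<exists>j\<in>Q. (x j)\<^sup>2 \<le> b"
  shows "\<exists>H'\<subseteq>G. card H' < h \<and> (\<Sum>j\<in>G - H'. (x j)\<^sup>2) \<le> (\<Sum>j\<in>G - {i} - H. (x j)\<^sup>2) + b"
proof -
  define Q where "Q = insert i H"
  have finH: "finite H" using H fin finite_subset by blast
  have Q: "Q \<subseteq> G" "card Q = Suc (card H)" using H i finH by (auto simp: Q_def card_insert_if)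
  have eq: "G - Q = G - {i} - H" by (auto simp: Q_def)
  show ?thesis
  proof (cases "card Q = h")
    case False
    then show ?thesis using Q H b eq by (intro exI[of _ Q]) auto
  next
    case True
    then obtain j where j: "j \<in> Q" "(x j)\<^sup>2 \<le> b" using small Q by blast
    have "G - (Q - {j}) = insert j (G - Q)" using j Q by auto
    then have "(\<Sum>j\<in>G - (Q - {j}). (x j)\<^sup>2) = (x j)\<^sup>2 + (\<Sum>j\<in>G - Q. (x j)\<^sup>2)"
      using fin j by simp
    moreover have "card (Q - {j}) < h"
      using True j H(2) Q(2) finH by (auto simp: Q_def card_Diff_singleton_if)
    ultimately show ?thesis using Q j eq by (intro exI[of _ "Q - {j}"]) auto
  qed
qed

text \<open>Here \<open>q\<close> stands for \<open>\<delta>\<^bsup>1/4\<^esup>\<close>, and \<open>snr\<close> is the signal-to-noise assumption without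
  the factor \<open>\<kappa>\<^sup>2\<close>.\<close>
locale noisy_sparse =
  fixes m n K :: nat and A :: "nat \<Rightarrow> nat \<Rightarrow> real" and x v y :: "nat \<Rightarrow> real"
    and q \<mu> M R :: real and S :: "nat set"
  assumes rip: "rip_holds m n A (2 * K) (q ^ 4)"
    and q: "0 < q" "q \<le> 1 / 20"
    and S_def: "S = supp n x" and card_S: "card S = K" and K: "K \<ge> 1"
    and x_lower: "\<And>i. i \<in> S \<Longrightarrow> \<mu> \<le> \<bar>x i\<bar>"
    and x_upper: "\<And>i. i \<in> S \<Longrightarrow> \<bar>x i\<bar> \<le> M"
    and \<mu>: "0 < \<mu>"
    and R_def: "R = sqrt K * M"
    and snr: "sqn m v \<le> q ^ 6 * sqn m (mv n A x)"
    and y_def: "y = (\<lambda>j. mv n A x j + v j)"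
begin

section \<open>Norm bounds for signal, noise and measurements\<close>

lemma finite_S: "finite S" and S_subset: "S \<subseteq> {..<n}"
  by (auto simp: S_def supp_def)

lemma M_pos: "0 < M"
proof -
  obtain i where "i \<in> S" using card_S K by fastforce
  then show ?thesis using x_lower x_upper \<mu> by fastforce
qed

lemma R_pos: "0 < R" and R_sq: "R\<^sup>2 = K * M\<^sup>2"
  using K M_pos by (auto simp: R_def power_mult_distrib)

lemma q_powers: "q ^ 4 \<le> q ^ 3" "q ^ 4 \<le> q\<^sup>2" "q ^ 3 \<le> q\<^sup>2" "q\<^sup>2 \<le> 1 / 400"
  using q power_decreasing[of 3 4 q] power_decreasing[of 2 4 q] power_decreasing[of 2 3 q]
    power_mono[of q "1/20" 2] by (auto simp: power_divide)

lemma sqn_eq_sum: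
  assumes "Q \<subseteq> {..<n}" "\<And>i. i < n \<Longrightarrow> i \<notin> Q \<Longrightarrow> z i = 0"
  shows "sqn n z = (\<Sum>i\<in>Q. (z i)\<^sup>2)"
  unfolding sqn_def by (rule sum.mono_neutral_right) (use assms in auto)

lemma sqn_x: "sqn n x = (\<Sum>i\<in>S. (x i)\<^sup>2)"
  by (rule sqn_eq_sum) (auto simp: S_def supp_def)

lemma x_sq_le: "i \<in> S \<Longrightarrow> (x i)\<^sup>2 \<le> M\<^sup>2"
  using x_upper[of i] M_pos abs_le_square_iff[of "x i" M] by simp

lemma sqn_x_le: "sqn n x \<le> R\<^sup>2"
  using sum_bounded_above[of S "\<lambda>i. (x i)\<^sup>2" "M\<^sup>2"] x_sq_le by (simp add: sqn_x R_sq card_S)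

lemma sqn_Ax_le: "sqn m (mv n A x) \<le> (1 + q ^ 4) * sqn n x"
  using rip card_S by (auto simp: rip_holds_def S_def)

lemma noise: "sqn m v \<le> 2 * q ^ 6 * (K * M\<^sup>2)"
proof -
  have "(1 + q ^ 4) * sqn n x \<le> 2 * R\<^sup>2"
    using q_powers sqn_x_le by (intro mult_mono) (auto simp: sqn_eq_L2_set)
  then have "q ^ 6 * sqn m (mv n A x) \<le> q ^ 6 * (2 * R\<^sup>2)"
    using sqn_Ax_le q by (intro mult_left_mono) auto
  then show ?thesis using snr by (simp add: R_sq)
qed

lemma norm_noise: "L2_set v {..<m} \<le> 3 / 2 * q ^ 3 * R"
proof (rule power2_le_imp_le)
  have "(3 / 2 * q ^ 3 * R)\<^sup>2 = 9 / 4 * q ^ 6 * (K * M\<^sup>2)"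
    by (simp add: power_mult_distrib R_sq power_divide flip: power_mult)
  \<comment> \<open>\<open>3 / 2\<close> serves as a rational upper bound for the square root of
    2.\<close>
  moreover have "2 * q ^ 6 * (K * M\<^sup>2) \<le> 9 / 4 * q ^ 6 * (K * M\<^sup>2)"
    using q by (intro mult_right_mono) auto
  ultimately show "(L2_set v {..<m})\<^sup>2 \<le> (3 / 2 * q ^ 3 * R)\<^sup>2"
    using noise unfolding sqn_eq_L2_set by linarith
qed (use q R_pos in auto)

lemma norm_Ax: "L2_set (mv n A x) {..<m} \<le> 2 * R"
proof (rule power2_le_imp_le)
  have "(1 + q ^ 4) * sqn n x \<le> 4 * R\<^sup>2"
    using q_powers sqn_x_le by (intro mult_mono) (auto simp: sqn_eq_L2_set)
  then show "(L2_set (mv n A x) {..<m})\<^sup>2 \<le> (2 * R)\<^sup>2"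
    using sqn_Ax_le by (simp add: sqn_eq_L2_set power_mult_distrib)
qed (use R_pos in auto)

lemma q3_R: "q ^ 3 * R \<le> q\<^sup>2 * R" "q ^ 3 * R \<le> 1 / 400 * R"
  using q_powers R_pos by (intro mult_right_mono; simp)+

text \<open>The noise enters mainly through its cross term with \<open>mv n A x\<close>, of order
  \<open>q ^ 3 * R\<^sup>2\<close>, relaxed here to \<open>q\<^sup>2 * R\<^sup>2\<close>. The
  constant \<open>10\<close> covers \<open>15 / 2\<close> from the noise and \<open>1\<close> from
  the isometry defect.\<close>

lemma sqn_y_le: "sqn m y \<le> sqn n x + 10 * q\<^sup>2 * R\<^sup>2"
proof -
  define a b where "a = L2_set (mv n A x) {..<m}" and "b = L2_set v {..<m}"
  have ab: "0 \<le> a" "0 \<le> b" "a \<le> 2 * R" "b \<le> 3 / 2 * q ^ 3 * R" "b \<le> R"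
    using norm_Ax norm_noise q3_R R_pos unfolding a_def b_def
    by (simp_all only: L2_set_nonneg)
  have "L2_set y {..<m} \<le> a + b"
    unfolding y_def a_def b_def by (rule L2_set_triangle_ineq)
  then have "sqn m y \<le> (a + b)\<^sup>2"
    unfolding sqn_eq_L2_set by (intro power_mono) auto
  also have "\<dots> = a\<^sup>2 + (2 * a + b) * b"
    by (simp add: power2_eq_square algebra_simps)
  also have "\<dots> \<le> (1 + q ^ 4) * sqn n x + (5 * R) * (3 / 2 * q\<^sup>2 * R)"
  proof (rule add_mono)
    show "a\<^sup>2 \<le> (1 + q ^ 4) * sqn n x" using sqn_Ax_le by (simp add: a_def sqn_eq_L2_set)
    show "(2 * a + b) * b \<le> (5 * R) * (3 / 2 * q\<^sup>2 * R)"
    proof (rule mult_mono)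
      show "2 * a + b \<le> 5 * R" using ab by linarith
      show "b \<le> 3 / 2 * q\<^sup>2 * R" using ab(4) q3_R(1) by linarith
    qed (use ab R_pos in auto)
  qed
  also have "\<dots> \<le> sqn n x + 10 * q\<^sup>2 * R\<^sup>2"
  proof -
    have "q ^ 4 * sqn n x \<le> q\<^sup>2 * R\<^sup>2"
      using q_powers sqn_x_le by (intro mult_mono) (auto simp: sqn_eq_L2_set)
    moreover have "0 \<le> q\<^sup>2 * R\<^sup>2" by simp
    moreover have "(1 + q ^ 4) * sqn n x + (5 * R) * (3 / 2 * q\<^sup>2 * R)
        = sqn n x + q ^ 4 * sqn n x + 15 / 2 * (q\<^sup>2 * R\<^sup>2)"
      by (simp add: power2_eq_square algebra_simps)
    ultimately show ?thesis by linarith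
  qed
  finally show ?thesis .
qed

section \<open>Residuals as noisy measurements of the remaining signal\<close>

text \<open>Subtracting the least-squares coefficients from \<open>x\<close> shows that a residual
  is again a noisy measurement, of a vector \<open>d\<close> with at most \<open>2 * K\<close>
  nonzero entries; this is why the isometry has order \<open>2 * K\<close>. The norm of
  \<open>d\<close> is controlled because the residual is no longer than \<open>y\<close>.\<close>

lemma ls_resid_repr:
  assumes T: "finite T" "T \<subseteq> {..<n}" "card T \<le> K"
  obtains d where "ls_resid m n A y T = (\<lambda>j. mv n A d j + v j)"
    and "supp n d \<subseteq> S \<union> T" and "\<forall>i\<in>S - T. d i = x i"
    and "L2_set d {..<n} \<le> 8 * R" and "L2_set (mv n A d) {..<m} \<le> 4 * R"
    and "(1 - q ^ 4) * sqn n d \<le> sqn m (mv n A d)"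
proof -
  define r where "r = ls_resid m n A y T"
  obtain u where u: "\<And>i. i \<notin> T \<Longrightarrow> u i = 0" "r = (\<lambda>j. y j - mv n A u j)"
    by (rule ls_resid_obtain[OF T(1,2), of m A y]) (auto simp: r_def)
  define d where "d = (\<lambda>i. x i - u i)"
  have r: "r = (\<lambda>j. mv n A d j + v j)"
    by (auto simp: u(2) d_def y_def mv_diff)
  have sup: "supp n d \<subseteq> S \<union> T"
    using u(1) by (force simp: d_def supp_def S_def)
  have "card (supp n d) \<le> card (S \<union> T)"
    using sup T finite_S by (intro card_mono) auto
  also have "\<dots> \<le> 2 * K" using card_Un_le[of S T] card_S T by simp
  finally have lower: "(1 - q ^ 4) * sqn n d \<le> sqn m (mv n A d)"
    using rip by (auto simp: rip_holds_def)
  have "L2_set r {..<m} \<le> L2_set y {..<m}"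
    using sqn_ls_resid_le[OF T(1,2), of m A y]
    by (auto simp: sqn_eq_L2_set r_def intro: power2_le_imp_le)
  also have "\<dots> \<le> L2_set (mv n A x) {..<m} + L2_set v {..<m}"
    unfolding y_def by (rule L2_set_triangle_ineq)
  finally have nr: "L2_set r {..<m} \<le> 3 * R"
    using norm_Ax norm_noise q3_R R_pos by linarith
  have "mv n A d = (\<lambda>j. r j + - v j)" by (auto simp: r)
  then have "L2_set (mv n A d) {..<m} \<le> L2_set r {..<m} + L2_set (\<lambda>j. - v j) {..<m}"
    by (simp only: L2_set_triangle_ineq)
  moreover have "L2_set (\<lambda>j. - v j) {..<m} = L2_set v {..<m}" by (simp add: L2_set_def)
  ultimately have up: "L2_set (mv n A d) {..<m} \<le> 4 * R"
    using nr norm_noise q3_R R_pos by linarith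
  have nd: "L2_set d {..<n} \<le> 8 * R"
  proof (rule power2_le_imp_le)
    \<comment> \<open>The crude factor \<open>1 / 4\<close> at most doubles the bound
      \<open>4 * R\<close> when passing from \<open>mv n A d\<close> back to
      \<open>d\<close>.\<close>
    have "1 / 4 * sqn n d \<le> (1 - q ^ 4) * sqn n d"
      using q_powers by (intro mult_right_mono) (auto simp: sqn_eq_L2_set)
    also have "\<dots> \<le> (4 * R)\<^sup>2"
      using lower power_mono[OF up, of 2] by (simp add: sqn_eq_L2_set)
    finally show "(L2_set d {..<n})\<^sup>2 \<le> (8 * R)\<^sup>2"
      by (simp add: sqn_eq_L2_set power_mult_distrib)
  qed (use R_pos in auto)
  show ?thesis
    by (rule that[of d]) (use r sup u(1) lower up nd in \<open>auto simp: r_def d_def\<close>)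
qed

text \<open>This is \<open>correlation_lower_bound\<close> for the remainder \<open>d\<close>, which
  agrees with \<open>x\<close> on \<open>Q\<close>. The constant is 8 + 3: \<open>8\<close> from the
  norm of \<open>d\<close>, with \<open>q ^ 4\<close> relaxed to \<open>q ^ 3\<close>, and
  \<open>3\<close> from twice the noise norm.\<close>

lemma exists_small_entry:
  assumes T: "finite T" "T \<subseteq> {..<n}" "card T \<le> K"
    and Q: "Q \<subseteq> S - T" "Q \<noteq> {}"
    and g: "\<And>i. i \<in> Q \<Longrightarrow> \<bar>ip m (col A i) (ls_resid m n A y T)\<bar> \<le> g"
  shows "\<exists>i\<in>Q. \<bar>x i\<bar> \<le> g + 11 * q ^ 3 * R / sqrt (card Q)"
proof -
  obtain d where d: "ls_resid m n A y T = (\<lambda>j. mv n A d j + v j)" "supp n d \<subseteq> S \<union> T"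
      "\<forall>i\<in>S - T. d i = x i" "L2_set d {..<n} \<le> 8 * R"
    by (rule ls_resid_repr[OF T]) blast
  have card: "card (S \<union> T) \<le> 2 * K" using card_Un_le[of S T] card_S T by simp
  have "q ^ 4 \<le> 1" using q_powers by linarith
  have "\<exists>i\<in>Q. \<bar>d i\<bar> \<le> g + (q ^ 4 * L2_set d {..<n} + 2 * L2_set v {..<m}) / sqrt (card Q)"
    by (rule correlation_lower_bound[OF rip, of "S \<union> T"])
      (use \<open>q ^ 4 \<le> 1\<close> T finite_S S_subset card d(1,2) Q g in auto)
  then obtain i where i: "i \<in> Q"
      "\<bar>d i\<bar> \<le> g + (q ^ 4 * L2_set d {..<n} + 2 * L2_set v {..<m}) / sqrt (card Q)" by blast
  have "q ^ 4 * L2_set d {..<n} \<le> q ^ 3 * (8 * R)"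
    using q_powers d(4) q by (intro mult_mono) auto
  then have "(q ^ 4 * L2_set d {..<n} + 2 * L2_set v {..<m}) / sqrt (card Q) \<le> 11 * q ^ 3 * R / sqrt (card Q)"
    using norm_noise by (intro divide_right_mono) auto
  then show ?thesis using i d(3) Q by fastforce
qed

text \<open>The isometry, applied to a unit vector, bounds the squared norm of the column in
  \<open>sqn_ls_resid_insert\<close>.\<close>

lemma correlation_sq_le_drop:
  assumes "finite T" "insert t T \<subseteq> {..<n}"
  shows "(ip m (col A t) (ls_resid m n A y T))\<^sup>2
      \<le> (1 + q ^ 4) * (sqn m (ls_resid m n A y T) - sqn m (ls_resid m n A y (insert t T)))"
    and "sqn m (ls_resid m n A y (insert t T)) \<le> sqn m (ls_resid m n A y T)"
proof -
  define e where "e = (\<lambda>i. if i = t then 1 else 0 :: real)"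
  have "supp n e \<subseteq> {t}" by (auto simp: supp_def e_def)
  then have "card (supp n e) \<le> 2 * K" using card_mono[of "{t}" "supp n e"] K by simp
  then have "sqn m (mv n A e) \<le> (1 + q ^ 4) * sqn n e"
    using rip by (auto simp: rip_holds_def)
  moreover have "mv n A e = col A t" using assms by (simp add: e_def mv_unit)
  moreover have "sqn n e = 1" using sqn_eq_sum[of "{t}" e] assms by (simp add: e_def)
  ultimately have c: "sqn m (col A t) \<le> 1 + q ^ 4" by simp
  show mono: "sqn m (ls_resid m n A y (insert t T)) \<le> sqn m (ls_resid m n A y T)"
  proof -
    obtain u where u: "\<And>i. i \<notin> T \<Longrightarrow> u i = 0"
        "ls_resid m n A y T = (\<lambda>j. y j - mv n A u j)"
      by (rule ls_resid_obtain[of T n m A y]) (use assms in auto)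
    show ?thesis
      unfolding u(2)
      by (rule ls_resid_obtain[of "insert t T" n m A y]) (use assms u(1) in auto)
  qed
  show "(ip m (col A t) (ls_resid m n A y T))\<^sup>2
      \<le> (1 + q ^ 4) * (sqn m (ls_resid m n A y T) - sqn m (ls_resid m n A y (insert t T)))"
    using sqn_ls_resid_insert[OF assms, of m A y] mult_right_mono[OF c] mono
    by (meson diff_ge_0_iff_ge order_trans)
qed

text \<open>The remainder \<open>d\<close> has at least the energy of the missed entries, where it
  agrees with \<open>x\<close>. The isometry costs \<open>q\<^sup>2 * R\<^sup>2\<close> and the
  cross term with the noise twice \<open>6 * q\<^sup>2 * R\<^sup>2\<close>, hence
  \<open>13\<close>.\<close>

lemma residual_lower_bound:
  assumes T: "finite T" "T \<subseteq> {..<n}" "card T \<le> K"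
  shows "(\<Sum>i\<in>S - T. (x i)\<^sup>2) - 13 * q\<^sup>2 * R\<^sup>2 \<le> sqn m (ls_resid m n A y T)"
proof -
  define r where "r = ls_resid m n A y T"
  obtain d where d: "r = (\<lambda>j. mv n A d j + v j)" "\<forall>i\<in>S - T. d i = x i"
      "L2_set (mv n A d) {..<m} \<le> 4 * R" "(1 - q ^ 4) * sqn n d \<le> sqn m (mv n A d)"
    unfolding r_def by (rule ls_resid_repr[OF T]) blast
  define E where "E = (\<Sum>i\<in>S - T. (x i)\<^sup>2)"
  have "E = (\<Sum>i\<in>S - T. (d i)\<^sup>2)"
    unfolding E_def by (rule sum.cong) (auto simp: d(2))
  also have "\<dots> \<le> sqn n d"
    unfolding sqn_def using S_subset by (intro sum_mono2) auto
  finally have E: "E \<le> sqn n d" .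
  have "E \<le> (\<Sum>i\<in>S. (x i)\<^sup>2)"
    unfolding E_def using finite_S by (intro sum_mono2) auto
  then have ER: "0 \<le> E" "E \<le> R\<^sup>2"
    using sqn_x_le by (auto simp: sqn_x E_def sum_nonneg)
  have "\<bar>ip m (mv n A d) v\<bar> \<le> L2_set (mv n A d) {..<m} * L2_set v {..<m}"
    by (rule abs_ip_le)
  also have "\<dots> \<le> (4 * R) * (3 / 2 * q\<^sup>2 * R)"
  proof (rule mult_mono)
    show "L2_set v {..<m} \<le> 3 / 2 * q\<^sup>2 * R" using norm_noise q3_R(1) by linarith
  qed (use d(3) R_pos in auto)
  finally have cross: "\<bar>ip m (mv n A d) v\<bar> \<le> 6 * q\<^sup>2 * R\<^sup>2"
    by (simp add: power2_eq_square algebra_simps)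
  have "(1 - q ^ 4) * E \<le> (1 - q ^ 4) * sqn n d"
    using E q_powers by (intro mult_left_mono) auto
  moreover have "q ^ 4 * E \<le> q\<^sup>2 * R\<^sup>2"
    using ER q_powers by (intro mult_mono) auto
  ultimately have "E - q\<^sup>2 * R\<^sup>2 \<le> sqn m (mv n A d)"
    using d(4) by (simp add: algebra_simps)
  moreover have "sqn m r = sqn m (mv n A d) + 2 * ip m (mv n A d) v + sqn m v"
    by (simp add: d(1) sqn_eq_ip ip_bilinear ip_commute[of m v "mv n A d"])
  moreover have "0 \<le> sqn m v" by (simp add: sqn_eq_L2_set)
  ultimately show ?thesis using cross by (simp add: E_def r_def abs_le_iff)
qed

section \<open>Residual drop in a single iteration\<close>

text \<open>Averaging over all missed indices, of which \<open>many\<close> guarantees enough, makes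
  the error small against \<open>\<mu>\<close>. The largest correlation must then nearly reach some
  missed entry, whose modulus is at least \<open>\<mu>\<close>.\<close>

lemma wrong_step_drop:
  assumes T: "finite T" "insert t T \<subseteq> {..<n}" "card T \<le> K"
    and greedy: "\<And>i. i \<in> S - T \<Longrightarrow> \<bar>ip m (col A i) (ls_resid m n A y T)\<bar>
                   \<le> \<bar>ip m (col A t) (ls_resid m n A y T)\<bar>"
    and many: "q\<^sup>2 * R\<^sup>2 \<le> card (S - T) * \<mu>\<^sup>2"
  shows "\<mu>\<^sup>2 / 4 \<le> sqn m (ls_resid m n A y T) - sqn m (ls_resid m n A y (insert t T))"
proof -
  define g where "g = \<bar>ip m (col A t) (ls_resid m n A y T)\<bar>"
  define N where "N = sqrt (card (S - T))"
  have "0 < q\<^sup>2 * R\<^sup>2" using q R_pos by simp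
  with many have ne: "S - T \<noteq> {}" by (metis card.empty mult_zero_left not_le of_nat_0)
  then have N: "0 < N" using finite_S by (simp add: N_def card_gt_0_iff)
  have "q * R \<le> N * \<mu>"
  proof (rule power2_le_imp_le)
    have "N\<^sup>2 = card (S - T)" by (simp add: N_def)
    then show "(q * R)\<^sup>2 \<le> (N * \<mu>)\<^sup>2" using many by (simp add: power_mult_distrib)
  qed (use N \<mu> in simp)
  then have "11 * q\<^sup>2 * (q * R) \<le> 11 * q\<^sup>2 * (N * \<mu>)"
    using q by (intro mult_left_mono) auto
  then have "11 * q ^ 3 * R / N \<le> 11 * q\<^sup>2 * \<mu>"
    using N by (simp add: field_simps power2_eq_square power3_eq_cube)
  also have "\<dots> \<le> 11 / 400 * \<mu>"
    using q_powers \<mu> by (intro mult_right_mono) auto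
  finally have err: "11 * q ^ 3 * R / N \<le> 11 / 400 * \<mu>" .
  obtain i where i: "i \<in> S - T" "\<bar>x i\<bar> \<le> g + 11 * q ^ 3 * R / N"
    using exists_small_entry[of T "S - T" g] T ne greedy by (auto simp: g_def N_def)
  \<comment> \<open>\<open>389 / 400\<close> is rounded down to \<open>3 / 4\<close>: its square
    \<open>9 / 16\<close>, halved because \<open>1 + q ^ 4\<close> is at most 2, still exceeds
    \<open>1 / 4\<close>.\<close>
  then have "3 / 4 * \<mu> \<le> g" using err x_lower[of i] \<mu> by auto
  then have "(3 / 4 * \<mu>)\<^sup>2 \<le> g\<^sup>2" using \<mu> by (intro power_mono) auto
  moreover define a where "a = sqn m (ls_resid m n A y T) - sqn m (ls_resid m n A y (insert t T))"
  have "g\<^sup>2 \<le> (1 + q ^ 4) * a" "0 \<le> a"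
    using correlation_sq_le_drop[OF T(1,2)] by (auto simp: g_def a_def)
  moreover have "(1 + q ^ 4) * a \<le> 2 * a"
    using \<open>0 \<le> a\<close> q_powers by (intro mult_right_mono) auto
  ultimately show ?thesis by (simp add: a_def power_mult_distrib power_divide)
qed

text \<open>With at least \<open>q\<^sup>2 * K\<close> indices in \<open>Q\<close>, the averaged
  error \<open>11 * q ^ 3 * R / sqrt (card Q)\<close> is at most \<open>11 * q\<^sup>2 * M\<close>.
  The squared form is what \<open>exempt_energy_step\<close> consumes.\<close>

lemma greedy_step_drop:
  assumes T: "finite T" "insert t T \<subseteq> {..<n}" "card T \<le> K"
    and greedy: "\<And>i. i \<in> S - T \<Longrightarrow> \<bar>ip m (col A i) (ls_resid m n A y T)\<bar>
                   \<le> \<bar>ip m (col A t) (ls_resid m n A y T)\<bar>"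
    and Q: "Q \<subseteq> S - T" "q\<^sup>2 * K \<le> card Q"
  shows "\<exists>i\<in>Q. (x i)\<^sup>2 \<le> sqn m (ls_resid m n A y T) - sqn m (ls_resid m n A y (insert t T))
           + 23 * q\<^sup>2 * M\<^sup>2"
proof -
  define g where "g = \<bar>ip m (col A t) (ls_resid m n A y T)\<bar>"
  define a where "a = sqn m (ls_resid m n A y T) - sqn m (ls_resid m n A y (insert t T))"
  define N where "N = sqrt (card Q)"
  define \<nu> where "\<nu> = 11 * q\<^sup>2 * M"
  have "0 < q\<^sup>2 * K" using q K by simp
  with Q have cardQ: "0 < card Q" by linarith
  then have N: "0 < N" "Q \<noteq> {}" by (auto simp: N_def)
  have "q * R \<le> N * M"
  proof (rule power2_le_imp_le)
    have "N\<^sup>2 = card Q" by (simp add: N_def)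
    moreover have "q\<^sup>2 * K * M\<^sup>2 \<le> card Q * M\<^sup>2"
      using Q by (intro mult_right_mono) auto
    ultimately show "(q * R)\<^sup>2 \<le> (N * M)\<^sup>2"
      by (simp add: power_mult_distrib R_sq)
  qed (use N M_pos in simp)
  then have "11 * q\<^sup>2 * (q * R) \<le> 11 * q\<^sup>2 * (N * M)"
    using q by (intro mult_left_mono) auto
  then have "11 * q ^ 3 * R / N \<le> \<nu>"
    using N by (simp add: \<nu>_def field_simps power2_eq_square power3_eq_cube)
  then obtain i where i: "i \<in> Q" "\<bar>x i\<bar> \<le> g + \<nu>"
    using exists_small_entry[of T Q g] T Q(1) N greedy by (force simp: g_def N_def)
  have xM: "\<bar>x i\<bar> \<le> M" "(x i)\<^sup>2 \<le> M\<^sup>2" using i Q x_upper x_sq_le by auto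
  have \<nu>: "0 \<le> \<nu>" using M_pos by (simp add: \<nu>_def)
  have g: "g\<^sup>2 \<le> (1 + q ^ 4) * a" "0 \<le> a"
    using correlation_sq_le_drop[OF T(1,2)] by (auto simp: g_def a_def)
  have "\<bar>x i\<bar> * \<nu> \<le> M * \<nu>"
    using xM \<nu> by (intro mult_right_mono)
  also have "M * \<nu> = 11 * q\<^sup>2 * M\<^sup>2" by (simp add: \<nu>_def power2_eq_square)
  finally have x\<nu>: "\<bar>x i\<bar> * \<nu> \<le> 11 * q\<^sup>2 * M\<^sup>2" .
  have pos: "0 \<le> q\<^sup>2 * M\<^sup>2" by simp
  have "(x i)\<^sup>2 \<le> a + 23 * q\<^sup>2 * M\<^sup>2"
  \<comment> \<open>Both exceptional cases give the bound directly. Otherwise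
    \<open>\<bar>x i\<bar> - \<nu>\<close> is positive and can be squared, and
    \<open>a < M\<^sup>2\<close> controls \<open>q ^ 4 * a\<close>; the constant \<open>23\<close>
    is 2 * 11 + 1.\<close>
  proof (cases "\<bar>x i\<bar> \<le> \<nu> \<or> M\<^sup>2 \<le> a")
    case True
    then show ?thesis
    proof
      assume "\<bar>x i\<bar> \<le> \<nu>"
      then have "\<bar>x i\<bar> * \<bar>x i\<bar> \<le> \<bar>x i\<bar> * \<nu>" by (intro mult_left_mono) auto
      then have "(x i)\<^sup>2 \<le> \<bar>x i\<bar> * \<nu>" by (simp add: power2_eq_square)
      then show ?thesis using x\<nu> g(2) pos by linarith
    next
      assume "M\<^sup>2 \<le> a"
      then show ?thesis using xM(2) pos by linarith
    qed
  next
    case False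
    then have "(\<bar>x i\<bar> - \<nu>)\<^sup>2 \<le> g\<^sup>2" using i(2) by (intro power_mono) auto
    moreover have "(\<bar>x i\<bar> - \<nu>)\<^sup>2 = (x i)\<^sup>2 - 2 * (\<bar>x i\<bar> * \<nu>) + \<nu>\<^sup>2"
      by (simp add: power2_diff)
    moreover have "q ^ 4 * a \<le> q\<^sup>2 * M\<^sup>2"
      using False g(2) q_powers by (intro mult_mono) auto
    moreover have "0 \<le> \<nu>\<^sup>2" by simp
    moreover have "(1 + q ^ 4) * a = a + q ^ 4 * a" by (simp add: algebra_simps)
    ultimately show ?thesis using g(1) x\<nu> by linarith
  qed
  then show ?thesis using i(1) by (auto simp: a_def)
qed

section \<open>Energy balance over all iterations\<close>

lemma omp_wrong_count:
  assumes omp: "omp_output m n A y K T" and many: "q\<^sup>2 * R\<^sup>2 \<le> card (T - S) * \<mu>\<^sup>2"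
  shows "card (T - S) * \<mu>\<^sup>2 \<le> 188 * q\<^sup>2 * R\<^sup>2"
proof -
  obtain t where t: "\<And>k. k \<in> {1..K} \<Longrightarrow> t k < n \<and> t k \<notin> t ` {1..<k} \<and>
           (\<forall>i<n. i \<notin> t ` {1..<k} \<longrightarrow>
              \<bar>ip m (col A i) (ls_resid m n A y (t ` {1..<k}))\<bar>
                \<le> \<bar>ip m (col A (t k)) (ls_resid m n A y (t ` {1..<k}))\<bar>)"
      and T: "T = t ` {1..K}"
    using omp unfolding omp_output_def by blast
  define B where "B k = t ` {1..k}" for k
  define f where "f k = sqn m (ls_resid m n A y (B k))" for k
  define G where "G k = S - B k" for k
  define W where "W k = card (B k - S)" for k
  have B_Suc: "B (Suc k) = insert (t (Suc k)) (B k)" for k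
    by (simp add: B_def atLeastAtMostSuc_conv)
  have B_fin: "finite (B k)" for k by (simp add: B_def)
  have B_sub: "B k \<subseteq> {..<n}" if "k \<le> K" for k
    using t that by (fastforce simp: B_def)
  have new: "t (Suc k) \<notin> B k" if "k < K" for k
    using t[of "Suc k"] that by (simp add: B_def atLeastLessThanSuc_atLeastAtMost)
  have greedy: "\<bar>ip m (col A i) (ls_resid m n A y (B k))\<bar>
      \<le> \<bar>ip m (col A (t (Suc k))) (ls_resid m n A y (B k))\<bar>" if "k < K" "i \<in> G k" for k i
    using t[of "Suc k"] that S_subset
    by (force simp: B_def G_def atLeastLessThanSuc_atLeastAtMost)
  have card_B: "card (B k) = k" if "k \<le> K" for k
    using that
  proof (induction k)
    case (Suc k)
    then show ?case using new[of k] B_fin by (simp add: B_Suc)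
  qed (simp add: B_def)
  have TB: "T = B K" by (simp add: T B_def)
  \<comment> \<open>\<open>S\<close> and \<open>B K\<close> have equal size, so at the end as many
    true indices are missed as wrong ones are chosen, and earlier at least as many are missed. This
    carries \<open>many\<close> to every step.\<close>
  have "card (S - B K) = card (B K - S)"
    using card_Diff_subset_Int[of S "B K"] card_Diff_subset_Int[of "B K" S] card_S card_B[of K] B_fin finite_S
    by (simp add: Int_commute)
  then have card_G: "card (T - S) \<le> card (G k)" if "k \<le> K" for k
    using that card_mono[of "S - B k" "S - B K"] finite_S by (force simp: TB G_def B_def)
  have many': "q\<^sup>2 * R\<^sup>2 \<le> card (G k) * \<mu>\<^sup>2" if "k \<le> K" for k
    by (rule order_trans[OF many]) (use card_G[OF that] in \<open>auto intro!: mult_right_mono\<close>)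
  \<comment> \<open>The least size for which \<open>greedy_step_drop\<close> applies; sets with
    fewer than \<open>h\<close> elements have at most \<open>q\<^sup>2 * K\<close>.\<close>
  define h where "h = nat \<lceil>q\<^sup>2 * K\<rceil>"
  have "0 < q\<^sup>2 * K" using q K by simp
  then have h: "0 < h" "q\<^sup>2 * K \<le> h" "h - 1 \<le> q\<^sup>2 * K"
    unfolding h_def by linarith+
  define D where "D = 23 * q\<^sup>2 * M\<^sup>2"
  have D: "0 \<le> D" by (simp add: D_def)
  \<comment> \<open>Downward induction from \<open>K\<close>, where \<open>H\<close> is empty, to 0;
    the terms \<open>real 0\<close> and \<open>W 0\<close> make the goal an instance of the
    invariant. Going back one step, a correct selection returns to \<open>G\<close> at the price of
    its drop plus \<open>D\<close>, while a wrong one leaves \<open>G\<close> unchanged and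
    contributes \<open>\<mu>\<^sup>2 / 4\<close>.\<close>
  have "\<exists>H\<subseteq>G 0. card H < h \<and> (\<Sum>j\<in>G 0 - H. (x j)\<^sup>2)
      \<le> (\<Sum>j\<in>G K. (x j)\<^sup>2) + (f 0 - f K) + (real K - real 0) * D - (real (W K) - real (W 0)) * (\<mu>\<^sup>2 / 4)"
    using le0[of K]
  proof (induction rule: inc_induct)
    case base
    show ?case using h by (intro exI[of _ "{}"]) auto
  next
    case (step k)
    then have k: "k < K" by simp
    obtain H where H: "H \<subseteq> G (Suc k)" "card H < h" "(\<Sum>j\<in>G (Suc k) - H. (x j)\<^sup>2)
      \<le> (\<Sum>j\<in>G K. (x j)\<^sup>2) + (f (Suc k) - f K) + (real K - real (Suc k)) * D
        - (real (W K) - real (W (Suc k))) * (\<mu>\<^sup>2 / 4)"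
      using step.IH by blast
    have sub: "insert (t (Suc k)) (B k) \<subseteq> {..<n}" using B_sub[of "Suc k"] k by (simp add: B_Suc)
    show ?case
    proof (cases "t (Suc k) \<in> S")
      case True
      have G: "G (Suc k) = G k - {t (Suc k)}" "t (Suc k) \<in> G k"
        using True new[OF k] by (auto simp: G_def B_Suc)
      have W: "W (Suc k) = W k" using True by (simp add: W_def B_Suc)
      have "f (Suc k) \<le> f k"
        unfolding f_def B_Suc by (rule correlation_sq_le_drop(2)[OF B_fin sub])
      then have b: "0 \<le> f k - f (Suc k) + D" using D by simp
      have "\<exists>j\<in>Q. (x j)\<^sup>2 \<le> f k - f (Suc k) + D" if "Q \<subseteq> G k" "card Q = h" for Q
        unfolding f_def B_Suc D_def
        by (rule greedy_step_drop) (use B_fin sub card_B k greedy h that in \<open>auto simp: G_def\<close>)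
      then obtain H' where "H' \<subseteq> G k" "card H' < h"
          "(\<Sum>j\<in>G k - H'. (x j)\<^sup>2) \<le> (\<Sum>j\<in>G k - {t (Suc k)} - H. (x j)\<^sup>2) + (f k - f (Suc k) + D)"
        using exempt_energy_step[of "G k" "t (Suc k)" H h "f k - f (Suc k) + D" x] G H(1,2) b finite_S
        by (auto simp: G_def)
      then show ?thesis using H(3) unfolding G(1) W
        by (intro exI[of _ H']) (simp add: algebra_simps)
    next
      case False
      have G: "G (Suc k) = G k" using False by (auto simp: G_def B_Suc)
      have W: "W (Suc k) = Suc (W k)"
        using False new[OF k] B_fin by (simp add: W_def B_Suc insert_Diff_if)
      have "\<mu>\<^sup>2 / 4 \<le> f k - f (Suc k)"
        unfolding f_def B_Suc
        by (rule wrong_step_drop) (use B_fin sub card_B k greedy many' in \<open>auto simp: G_def\<close>)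
      then show ?thesis using H D unfolding G W
        by (intro exI[of _ H]) (simp add: field_simps)
    qed
  qed
  moreover have "G 0 = S" "W 0 = 0" "W K = card (T - S)"
    by (simp_all add: G_def W_def B_def T)
  ultimately obtain H where H: "H \<subseteq> S" "card H < h" "(\<Sum>j\<in>S - H. (x j)\<^sup>2)
      \<le> (\<Sum>j\<in>G K. (x j)\<^sup>2) + (f 0 - f K) + K * D - card (T - S) * (\<mu>\<^sup>2 / 4)"
    by auto
  have "(\<Sum>j\<in>H. (x j)\<^sup>2) \<le> card H * M\<^sup>2"
    using H(1) x_sq_le sum_bounded_above[of H "\<lambda>j. (x j)\<^sup>2" "M\<^sup>2"] by auto
  also have "\<dots> \<le> (q\<^sup>2 * K) * M\<^sup>2"
    using H(2) h(1,3) by (intro mult_right_mono) auto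
  finally have "(\<Sum>j\<in>H. (x j)\<^sup>2) \<le> q\<^sup>2 * R\<^sup>2" by (simp add: R_sq)
  then have "sqn n x - q\<^sup>2 * R\<^sup>2 \<le> (\<Sum>j\<in>S - H. (x j)\<^sup>2)"
    using sum.subset_diff[OF H(1) finite_S, of "\<lambda>j. (x j)\<^sup>2"] by (simp add: sqn_x)
  moreover have "K * D = 23 * q\<^sup>2 * R\<^sup>2" by (simp add: D_def R_sq)
  moreover have "f 0 \<le> sqn n x + 10 * q\<^sup>2 * R\<^sup>2"
    using sqn_ls_resid_le[of "B 0" n m A y] B_fin B_sub sqn_y_le by (simp add: f_def)
  moreover have "(\<Sum>j\<in>G K. (x j)\<^sup>2) - 13 * q\<^sup>2 * R\<^sup>2 \<le> f K"
    unfolding f_def G_def by (rule residual_lower_bound) (use B_fin B_sub card_B in auto)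
  \<comment> \<open>\<open>188\<close> is 4 * (1 + 10 + 13 + 23): exempted entries, initial
    residual, final residual and the accumulated \<open>D\<close>.\<close>
  ultimately show ?thesis using H(3) by linarith
qed

end

section \<open>Choice of the constant and reduction to small isometry constants\<close>

theorem theorem3:
  shows "\<exists>C::real. C > 0 \<and>
    (\<forall>(m::nat) (n::nat) (K::nat) (A::nat \<Rightarrow> nat \<Rightarrow> real) (x::nat \<Rightarrow> real) (v::nat \<Rightarrow> real)
       (y::nat \<Rightarrow> real) (\<delta>::real) (\<kappa>::real) (T::nat set).
       K \<ge> 1 \<longrightarrow>
       (\<exists>c. 0 \<le> c \<and> c < 1 \<and> rip_holds m n A (2 * K) c) \<longrightarrow>
       \<delta> = ric m n A (2 * K) \<longrightarrow> 0 < \<delta> \<longrightarrow> \<delta> < 1 \<longrightarrow>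
       card (supp n x) = K \<longrightarrow>
       (\<forall>j<m. y j = mv n A x j + v j) \<longrightarrow>
       \<kappa> = Max {\<bar>x i\<bar> / \<bar>x j\<bar> | i j. i \<in> supp n x \<and> j \<in> supp n x} \<longrightarrow>
       (sqn m v = 0 \<or> sqn m (mv n A x) / sqn m v \<ge> \<kappa>^2 * \<delta> powr (-3/2)) \<longrightarrow>
       omp_output m n A y K T \<longrightarrow>
       real (card (T - supp n x)) / real (card (supp n x)) \<le> C * \<kappa>^2 * sqrt \<delta>)"
proof (intro exI[of _ 400] conjI allI impI)
  fix m n K :: nat and A :: "nat \<Rightarrow> nat \<Rightarrow> real" and x v y :: "nat \<Rightarrow> real"
    and \<delta> \<kappa> :: real and T :: "nat set"
  assume K: "K \<ge> 1" and ex: "\<exists>c. 0 \<le> c \<and> c < 1 \<and> rip_holds m n A (2 * K) c"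
    and \<delta>: "\<delta> = ric m n A (2 * K)" "0 < \<delta>" "\<delta> < 1" and card_S: "card (supp n x) = K"
    and y: "\<forall>j<m. y j = mv n A x j + v j"
    and \<kappa>: "\<kappa> = Max {\<bar>x i\<bar> / \<bar>x j\<bar> | i j. i \<in> supp n x \<and> j \<in> supp n x}"
    and snr: "sqn m v = 0 \<or> sqn m (mv n A x) / sqn m v \<ge> \<kappa>^2 * \<delta> powr (-3/2)"
    and omp: "omp_output m n A y K T"
  define S where "S = supp n x"
  define \<mu> M where "\<mu> = Min ((\<lambda>i. \<bar>x i\<bar>) ` S)" and "M = Max ((\<lambda>i. \<bar>x i\<bar>) ` S)"
  define q where "q = sqrt (sqrt \<delta>)"
  \<comment> \<open>The measurement equation is given only below \<open>m\<close>, whereas the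
    locale asks for equality of functions. \<open>v'\<close> repairs this and agrees with
    \<open>v\<close> below \<open>m\<close>.\<close>
  define v' where "v' = (\<lambda>j. y j - mv n A x j)"
  have fin: "finite S" by (simp add: S_def supp_def)
  have ne: "S \<noteq> {}" using card_S K by (auto simp: S_def)
  have bounds: "\<mu> \<le> \<bar>x i\<bar>" "\<bar>x i\<bar> \<le> M" if "i \<in> S" for i
    using fin that by (auto simp: \<mu>_def M_def)
  have "\<mu> \<in> (\<lambda>i. \<bar>x i\<bar>) ` S" "M \<in> (\<lambda>i. \<bar>x i\<bar>) ` S"
    unfolding \<mu>_def M_def using fin ne
    by (simp_all only: Min_in Max_in finite_imageI image_is_empty not_False_eq_True)
  then obtain i j where ij: "i \<in> S" "\<mu> = \<bar>x i\<bar>" "j \<in> S" "M = \<bar>x j\<bar>"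
    by (elim imageE) blast
  then have \<mu>: "0 < \<mu>" by (simp add: S_def supp_def)
  have q: "0 < q" "q\<^sup>2 = sqrt \<delta>" using \<delta> by (auto simp: q_def)
  have "q ^ 4 = (q\<^sup>2)\<^sup>2" by simp
  also have "\<dots> = \<delta>" unfolding q(2) using \<delta> by simp
  finally have q4: "q ^ 4 = \<delta>" .
  have ratio: "M / \<mu> \<le> \<kappa>"
  proof -
    have "{\<bar>x i\<bar> / \<bar>x j\<bar> | i j. i \<in> S \<and> j \<in> S} = (\<lambda>(i, j). \<bar>x i\<bar> / \<bar>x j\<bar>) ` (S \<times> S)" by auto
    then have "finite {\<bar>x i\<bar> / \<bar>x j\<bar> | i j. i \<in> S \<and> j \<in> S}" using fin by simp
    then show ?thesis unfolding \<kappa> S_def[symmetric] using ij by (intro Max_ge) auto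
  qed
  have "\<mu> \<le> M" using bounds ij(1) by force
  then have "1 \<le> M / \<mu>" using \<mu> by simp
  with ratio have \<kappa>1: "1 \<le> \<kappa>" by linarith
  have card_le: "card (T - S) \<le> K"
  proof -
    obtain t where "T = t ` {1..K}" using omp unfolding omp_output_def by blast
    then show ?thesis
      using card_image_le[of "{1..K}" t] card_mono[of T "T - S"] by simp
  qed
  have "real (card (T - S)) \<le> 400 * \<kappa>\<^sup>2 * q\<^sup>2 * K"
  proof (rule ccontr)
    assume "\<not> ?thesis"
    then have large: "400 * \<kappa>\<^sup>2 * q\<^sup>2 * K < card (T - S)" by simp
    \<comment> \<open>At most \<open>K\<close> selections can be wrong, so a violated bound forces
      \<open>q\<close> to be at most \<open>1 / 20\<close>; the constant \<open>400\<close> is the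
      square of 20.\<close>
    with card_le have "400 * \<kappa>\<^sup>2 * q\<^sup>2 * K < 1 * real K" by linarith
    then have "400 * \<kappa>\<^sup>2 * q\<^sup>2 < 1" by (rule mult_right_less_imp_less) simp
    moreover have "1 * q\<^sup>2 \<le> \<kappa>\<^sup>2 * q\<^sup>2" using \<kappa>1 by (intro mult_right_mono) auto
    ultimately have "q\<^sup>2 \<le> (1 / 20)\<^sup>2" by (simp add: power_divide)
    then have q20: "q \<le> 1 / 20" by (rule power2_le_imp_le) simp
    have "\<delta> powr (-3/2) = (q powr 4) powr (-3/2)" using q4 q by (simp add: powr_numeral)
    also have "\<dots> = q powr - 6" by (simp add: powr_powr)
    also have "\<dots> = 1 / q ^ 6" using q by (simp add: powr_minus powr_numeral divide_inverse)
    finally have powr: "\<delta> powr (-3/2) = 1 / q ^ 6" .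
    have "sqn m v \<le> q ^ 6 * sqn m (mv n A x)"
    proof (cases "sqn m v = 0")
      case True
      then show ?thesis using q by (simp add: sqn_eq_L2_set)
    next
      case False
      then have pos: "0 < sqn m v" by (simp add: sqn_eq_L2_set)
      have "1 * (1 / q ^ 6) \<le> \<kappa>\<^sup>2 * (1 / q ^ 6)" using \<kappa>1 q by (intro mult_right_mono) auto
      also have "\<dots> \<le> sqn m (mv n A x) / sqn m v" using snr False powr by simp
      finally show ?thesis using pos q by (simp add: field_simps)
    qed
    moreover have "sqn m v' = sqn m v" using y by (simp add: sqn_def v'_def)
    ultimately have snr': "sqn m v' \<le> q ^ 6 * sqn m (mv n A x)" by simp
    interpret noisy_sparse m n K A x v' y q \<mu> M "sqrt K * M" S
    proof
      show "rip_holds m n A (2 * K) (q ^ 4)"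
        unfolding q4 \<delta>(1) using ex by (rule rip_holds_ric)
    qed (use q q20 S_def card_S K bounds \<mu> snr' v'_def in auto)
    \<comment> \<open>This trades \<open>\<kappa> * \<mu>\<close> for \<open>M\<close>: the violated
      bound becomes an energy above \<open>400 * q\<^sup>2 * R\<^sup>2\<close>, with
      \<open>R = sqrt K * M\<close>, which both satisfies the premise of
      \<open>omp_wrong_count\<close> and contradicts its conclusion.\<close>
    have "M \<le> \<kappa> * \<mu>" using ratio \<mu> by (simp add: field_simps)
    then have "M\<^sup>2 \<le> \<kappa>\<^sup>2 * \<mu>\<^sup>2" using M_pos by (simp flip: power_mult_distrib)
    then have "400 * q\<^sup>2 * K * M\<^sup>2 \<le> 400 * q\<^sup>2 * K * (\<kappa>\<^sup>2 * \<mu>\<^sup>2)"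
      by (intro mult_left_mono) auto
    also have "\<dots> = (400 * \<kappa>\<^sup>2 * q\<^sup>2 * K) * \<mu>\<^sup>2" by simp
    also have "\<dots> < card (T - S) * \<mu>\<^sup>2" using large \<mu> by (intro mult_strict_right_mono) auto
    finally have gt: "400 * (q\<^sup>2 * (sqrt K * M)\<^sup>2) < card (T - S) * \<mu>\<^sup>2" by (simp add: R_sq mult.assoc)
    have pos: "0 < q\<^sup>2 * (sqrt K * M)\<^sup>2"
      using q(1) R_pos by (metis mult_pos_pos zero_less_power)
    have "card (T - S) * \<mu>\<^sup>2 \<le> 188 * q\<^sup>2 * (sqrt K * M)\<^sup>2"
      by (rule omp_wrong_count[OF omp]) (use gt pos in linarith)
    with gt pos show False by linarith
  qed
  then show "real (card (T - supp n x)) / real (card (supp n x)) \<le> 400 * \<kappa>^2 * sqrt \<delta>"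
    using K card_S q(2) by (simp add: S_def field_simps)
qed simp

end
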